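(* Let $\bm C\in\mathbb S^n_{++}$ and $s\in[n]$. Then the maximum-entropy sampling problem (MESP) with covariance matrix $\bm C$ is a special case of the D-optimal Data Fusion problem (DDF) with $d=n$: there exist a matrix $\bm D\in\mathbb S^n_{++}$, vectors $\bm f_1,\dots,\bm f_n\in\mathbb R^n$ and a constant $\gamma\in\mathbb R$ such that for every $S\subseteq[n]$ with $|S|=s$, $$\log\det \bm C_{S,S}=\log\det\Big(\bm D+\sum_{i\in S}\bm f_i\bm f_i^\top\Big)+\gamma .$$
   Context: $[n]=\{1,\dots,n\}$; $\mathbb S^n_{++}$ is the set of symmetric positive-definite $n\times n$ matrices; $\bm C_{S,S}$ is the principal submatrix of $\bm C$ indexed by $S$. MESP is $\max_{S\subseteq[n],|S|=s}\log\det\bm C_{S,S}$. DDF, for data $\bm D\in\mathbb S^d_{++}$, $\bm a_1,\dots,\bm a_n\in\mathbb R^d$ and $s\in[n]$, is $\max_{S\subseteq[n],|S|=s}\log\det(\bm D+\sum_{i\in S}\bm a_i\bm a_i^\top)$. "Special case" means that the objective functions agree on all feasible sets up to an additive constant. *)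

theory Defs
  imports Complex_Main
    "Jordan_Normal_Form.Determinant"
    "Jordan_Normal_Form.DL_Submatrix"
begin

text \<open>Indices are zero-based throughout: the index set \<open>[n]\<close> is rendered as \<open>{..<n}\<close>.\<close>

definition sym_pos_def :: "nat \<Rightarrow> real mat set" where
  "sym_pos_def n = {A \<in> carrier_mat n n. transpose_mat A = A \<and>
     (\<forall>x \<in> carrier_vec n. x \<noteq> 0\<^sub>v n \<longrightarrow> x \<bullet> (A *\<^sub>v x) > 0)}"

definition mesp_objective :: "real mat \<Rightarrow> nat set \<Rightarrow> real" where
  "mesp_objective C S = ln (det (submatrix C S S))"

text \<open>The product of the column matrix of \<open>v\<close> with its transpose, a \<open>d\<close> by \<open>d\<close> matrix.\<close>

definition outer_square :: "nat \<Rightarrow> real vec \<Rightarrow> real mat" where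
  "outer_square d v = mat_of_cols d [v] * transpose_mat (mat_of_cols d [v])"

text \<open>Matrices of unspecified dimension have no zero element, so the sum over \<open>S\<close> is taken in
  the additive group of \<open>d\<close> by \<open>d\<close> matrices. It is meaningful for finite \<open>S\<close>.\<close>

definition ddf_matrix :: "nat \<Rightarrow> real mat \<Rightarrow> (nat \<Rightarrow> real vec) \<Rightarrow> nat set \<Rightarrow> real mat" where
  "ddf_matrix d D a S = D + finsum (module_mat TYPE(real) d d) (\<lambda>i. outer_square d (a i)) S"

definition ddf_objective :: "nat \<Rightarrow> real mat \<Rightarrow> (nat \<Rightarrow> real vec) \<Rightarrow> nat set \<Rightarrow> real" where
  "ddf_objective d D a S = ln (det (ddf_matrix d D a S))"

end

theory Submission
  imports Defs
begin

text \<open>For small \<open>t > 0\<close> the matrix \<open>M = C - t I\<close> is positive definite; take \<open>D = M\<^sup>-\<^sup>1\<close> and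
  \<open>f\<^sub>i = e\<^sub>i / sqrt t\<close>. Then \<open>M (D + \<Sum>i\<in>S. f\<^sub>i f\<^sub>i\<^sup>T) = I + M P\<^sub>S / t\<close>, where \<open>P\<^sub>S\<close> is the
  coordinate projection: its columns outside \<open>S\<close> are unit vectors and its \<open>S\<close> by \<open>S\<close> block is
  \<open>C\<^sub>S\<^sub>S / t\<close>. Hence the two determinants differ by the factor \<open>t ^ s * det M\<close>.\<close>

section \<open>Positive definite matrices and their inverses\<close>

lemma sym_pos_defD:
  assumes "A \<in> sym_pos_def n"
  shows "A \<in> carrier_mat n n" "transpose_mat A = A"
    "\<And>x. x \<in> carrier_vec n \<Longrightarrow> x \<noteq> 0\<^sub>v n \<Longrightarrow> x \<bullet> (A *\<^sub>v x) > 0"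
  using assms by (auto simp: sym_pos_def_def)

lemma sym_pos_def_nonneg:
  assumes "A \<in> sym_pos_def n" "x \<in> carrier_vec n"
  shows "0 \<le> x \<bullet> (A *\<^sub>v x)"
proof (cases "x = 0\<^sub>v n")
  case True
  then show ?thesis
    using sym_pos_defD(1)[OF assms(1)] by simp
next
  case False
  then show ?thesis
    using sym_pos_defD(3)[OF assms] by simp
qed

lemma sym_pos_def_det_nonzero:
  assumes "A \<in> sym_pos_def n"
  shows "det A \<noteq> 0"
proof
  assume "det A = 0"
  then obtain v where v: "v \<in> carrier_vec n" "v \<noteq> 0\<^sub>v n" "A *\<^sub>v v = 0\<^sub>v n"
    using det_0_iff_vec_prod_zero[OF sym_pos_defD(1)[OF assms]] by auto
  then show False
    using sym_pos_defD(3)[OF assms v(1,2)] by simp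
qed

lemma symmetric_bilinear_commute:
  fixes A :: "real mat"
  assumes "A \<in> carrier_mat n n" "transpose_mat A = A" "x \<in> carrier_vec n" "y \<in> carrier_vec n"
  shows "y \<bullet> (A *\<^sub>v x) = x \<bullet> (A *\<^sub>v y)"
proof -
  have "y \<bullet> (A *\<^sub>v x) = (A *\<^sub>v y) \<bullet> x"
    using transpose_vec_mult_scalar[OF assms(1,3,4)] assms(2) by simp
  also have "\<dots> = x \<bullet> (A *\<^sub>v y)"
    using assms by (intro comm_scalar_prod[of _ n]) auto
  finally show ?thesis .
qed

lemma sym_pos_def_inverse:
  assumes A: "A \<in> sym_pos_def n"
  obtains B where "B \<in> sym_pos_def n" "A * B = 1\<^sub>m n" "B * A = 1\<^sub>m n"
proof -
  note c = sym_pos_defD(1)[OF A]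
  obtain B where B: "B \<in> carrier_mat n n" "A * B = 1\<^sub>m n" "B * A = 1\<^sub>m n"
    using det_non_zero_imp_unit[OF c sym_pos_def_det_nonzero[OF A], of "()"]
    unfolding Units_def ring_mat_def by auto
  have BT: "transpose_mat B \<in> carrier_mat n n"
    using B by simp
  \<comment> \<open>Symmetry of \<open>A\<close> makes the transpose of \<open>B\<close> another
    left inverse of \<open>A\<close>, so it agrees with \<open>B\<close> by uniqueness of
    inverses.\<close>
  have "transpose_mat B * A = transpose_mat (A * B)"
    using B(1) c sym_pos_defD(2)[OF A] by (simp add: transpose_mult[of _ n n])
  then have TA: "transpose_mat B * A = 1\<^sub>m n"
    using B by simp
  have "transpose_mat B = transpose_mat B * (A * B)"
    using B BT by simp
  also have "\<dots> = transpose_mat B * A * B"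
    using assoc_mult_mat[OF BT c B(1)] by simp
  also have "\<dots> = B"
    using TA B by simp
  finally have sym: "transpose_mat B = B" .
  have "x \<bullet> (B *\<^sub>v x) > 0" if x: "x \<in> carrier_vec n" "x \<noteq> 0\<^sub>v n" for x
  proof -
    \<comment> \<open>With this \<open>y\<close>, the form of \<open>B\<close> at \<open>x\<close>
      equals the form of \<open>A\<close> at \<open>y\<close>, because \<open>A\<close> sends
      \<open>y\<close> back to \<open>x\<close>.\<close>
    define y where "y = B *\<^sub>v x"
    have y: "y \<in> carrier_vec n"
      using B x by (simp add: y_def)
    have Ay: "A *\<^sub>v y = x"
      using assoc_mult_mat_vec[OF c B(1) x(1)] B x by (simp add: y_def)
    have "y \<noteq> 0\<^sub>v n"
      using Ay x c by auto
    then have "y \<bullet> (A *\<^sub>v y) > 0"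
      using sym_pos_defD(3)[OF A y] by simp
    then show ?thesis
      unfolding Ay using comm_scalar_prod[OF y x(1)] by (simp add: y_def)
  qed
  then have "B \<in> sym_pos_def n"
    using B sym by (auto simp: sym_pos_def_def)
  with B show ?thesis
    using that by blast
qed

section \<open>Subtracting a small multiple of the identity\<close>

lemma sym_pos_def_Cauchy_Schwarz:
  assumes A: "A \<in> sym_pos_def n" and x: "x \<in> carrier_vec n" and y: "y \<in> carrier_vec n"
  shows "(x \<bullet> (A *\<^sub>v y))\<^sup>2 \<le> (x \<bullet> (A *\<^sub>v x)) * (y \<bullet> (A *\<^sub>v y))"
proof (cases "y = 0\<^sub>v n")
  case True
  then have "A *\<^sub>v y = 0\<^sub>v n"
    using sym_pos_defD(1)[OF A] by (intro eq_vecI) auto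
  then show ?thesis
    using x True by simp
next
  case False
  note c = sym_pos_defD(1)[OF A]
  define p q r where "p = x \<bullet> (A *\<^sub>v x)" and "q = y \<bullet> (A *\<^sub>v y)" and "r = x \<bullet> (A *\<^sub>v y)"
  have q: "q > 0"
    using sym_pos_defD(3)[OF A y False] by (simp add: q_def)
  have r': "y \<bullet> (A *\<^sub>v x) = r"
    unfolding r_def by (rule symmetric_bilinear_commute[OF c sym_pos_defD(2)[OF A] x y])
  \<comment> \<open>Up to the factor \<open>q\<close>, this is the component of \<open>x\<close>
    orthogonal to \<open>y\<close> in the inner product of \<open>A\<close>. Its form value is
    \<open>q * (q * p - r * r)\<close>, so nonnegativity is the claim once \<open>q > 0\<close> is
    cancelled.\<close>
  define z where "z = q \<cdot>\<^sub>v x + (-r) \<cdot>\<^sub>v y"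
  have z: "z \<in> carrier_vec n"
    using x y by (simp add: z_def)
  have Ax: "A *\<^sub>v x \<in> carrier_vec n" and Ay: "A *\<^sub>v y \<in> carrier_vec n"
    using c x y by auto
  have Az: "A *\<^sub>v z = q \<cdot>\<^sub>v (A *\<^sub>v x) + (-r) \<cdot>\<^sub>v (A *\<^sub>v y)"
    unfolding z_def using c x y
    by (simp add: mult_add_distrib_mat_vec[of _ n n] mult_mat_vec[of _ n n])
  have "z \<bullet> (A *\<^sub>v z) = q * (q * p - r * r) - r * (q * r - r * q)"
    unfolding Az unfolding z_def using x y Ax Ay
    by (simp add: add_scalar_prod_distrib[of _ n] scalar_prod_add_distrib[of _ n]
        p_def[symmetric] q_def[symmetric] r_def[symmetric] r' algebra_simps)
  then have "0 \<le> q * (q * p - r * r)"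
    using sym_pos_def_nonneg[OF A z] by simp
  then have "0 \<le> q * p - r * r"
    using q by (simp add: zero_le_mult_iff)
  then show ?thesis
    by (simp add: p_def q_def r_def power2_eq_square mult.commute)
qed

text \<open>Since \<open>A\<close> maps column \<open>i\<close> of \<open>B\<close> to the unit
  vector \<open>i\<close>, Cauchy-Schwarz for \<open>x\<close> and that column bounds the square of
  \<open>x $ i\<close> by \<open>B $$ (i, i)\<close> times the form at \<open>x\<close>; summing
  over \<open>i\<close> gives the trace. The trace of the inverse thus serves as an upper bound for
  the reciprocal of the smallest eigenvalue, without any spectral theory.\<close>

lemma scalar_prod_self_le_inverse_trace:
  assumes A: "A \<in> sym_pos_def n" and B: "B \<in> carrier_mat n n" and AB: "A * B = 1\<^sub>m n"
    and x: "x \<in> carrier_vec n"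
  shows "x \<bullet> x \<le> (\<Sum>i<n. B $$ (i, i)) * (x \<bullet> (A *\<^sub>v x))"
proof -
  note c = sym_pos_defD(1)[OF A]
  have "(x $ i)\<^sup>2 \<le> B $$ (i, i) * (x \<bullet> (A *\<^sub>v x))" if i: "i < n" for i
  proof -
    have y: "col B i \<in> carrier_vec n"
      using B by auto
    have "A *\<^sub>v col B i = col (A * B) i"
      by (rule col_mult2[OF c B i, symmetric])
    then have Ay: "A *\<^sub>v col B i = unit_vec n i"
      using AB i by simp
    show ?thesis
      using sym_pos_def_Cauchy_Schwarz[OF A x y] B i x y unfolding Ay by (simp add: mult.commute)
  qed
  then have "(\<Sum>i<n. (x $ i)\<^sup>2) \<le> (\<Sum>i<n. B $$ (i, i) * (x \<bullet> (A *\<^sub>v x)))"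
    by (intro sum_mono) auto
  moreover have "x \<bullet> x = (\<Sum>i<n. (x $ i)\<^sup>2)"
    using x by (simp add: scalar_prod_def power2_eq_square lessThan_atLeast0)
  ultimately show ?thesis
    by (simp add: sum_distrib_right)
qed

lemma sym_pos_def_shift:
  assumes A: "A \<in> sym_pos_def n"
  obtains t where "t > 0" "A - t \<cdot>\<^sub>m 1\<^sub>m n \<in> sym_pos_def n"
proof -
  note c = sym_pos_defD(1)[OF A]
  obtain B where B: "B \<in> sym_pos_def n" "A * B = 1\<^sub>m n"
    using sym_pos_def_inverse[OF A] by blast
  note cB = sym_pos_defD(1)[OF B(1)]
  define T where "T = (\<Sum>i<n. B $$ (i, i))"
  have "B $$ (i, i) \<ge> 0" if i: "i < n" for i
  proof -
    have "B *\<^sub>v unit_vec n i = col B i"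
      using cB i by (intro eq_vecI) auto
    then show ?thesis
      using sym_pos_def_nonneg[OF B(1), of "unit_vec n i"] i cB by simp
  qed
  then have T: "T \<ge> 0"
    unfolding T_def by (intro sum_nonneg) auto
  \<comment> \<open>The trace bound yields \<open>x \<bullet> x \<le> T * q\<close>. Adding 1 to
    \<open>T\<close> makes the inequality strict and keeps the denominator positive even when
    \<open>T = 0\<close>, as for \<open>n = 0\<close>.\<close>
  define t where "t = 1 / (1 + T)"
  have t: "t > 0"
    using T by (simp add: t_def)
  have "x \<bullet> ((A - t \<cdot>\<^sub>m 1\<^sub>m n) *\<^sub>v x) > 0" if x: "x \<in> carrier_vec n" "x \<noteq> 0\<^sub>v n" for x
  proof -
    define q where "q = x \<bullet> (A *\<^sub>v x)"
    have q: "q > 0"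
      using sym_pos_defD(3)[OF A x] by (simp add: q_def)
    have "x \<bullet> x \<le> T * q"
      using scalar_prod_self_le_inverse_trace[OF A cB B(2) x(1)] by (simp add: T_def q_def)
    also have "\<dots> < (1 + T) * q"
      using q by (simp add: algebra_simps)
    finally have "t * (x \<bullet> x) < q"
      using T by (simp add: t_def field_simps)
    moreover have "(t \<cdot>\<^sub>m 1\<^sub>m n) *\<^sub>v x = t \<cdot>\<^sub>v x"
      using x by (intro eq_vecI) auto
    ultimately show ?thesis
      using x c
      by (simp add: minus_mult_distrib_mat_vec[of _ n n] scalar_prod_minus_distrib[of _ n] q_def)
  qed
  moreover have "transpose_mat (A - t \<cdot>\<^sub>m 1\<^sub>m n) = A - t \<cdot>\<^sub>m 1\<^sub>m n"
  proof -
    have "A $$ (j, i) = A $$ (i, j)" if "i < n" "j < n" for i j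
      using that c sym_pos_defD(2)[OF A] by (metis carrier_matD index_transpose_mat(1))
    then show ?thesis
      using c by (intro eq_matI) auto
  qed
  ultimately have "A - t \<cdot>\<^sub>m 1\<^sub>m n \<in> sym_pos_def n"
    using c by (auto simp: sym_pos_def_def minus_carrier_mat)
  with t show ?thesis
    using that by blast
qed

section \<open>The data fusion matrix for scaled unit vectors\<close>

lemma index_outer_square:
  assumes "v \<in> carrier_vec d" "i < d" "j < d"
  shows "outer_square d v $$ (i, j) = v $ i * v $ j"
  using assms by (simp add: outer_square_def scalar_prod_def mat_of_cols_def)

lemma outer_square_carrier [simp]: "outer_square d v \<in> carrier_mat d d"
  by (auto simp: outer_square_def mat_of_cols_def)

text \<open>Trades the sum in the abstract group \<open>module_mat\<close> for entrywise real sums,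
  which can be evaluated.\<close>

lemma finsum_outer_square:
  assumes "finite S" "\<And>i. i \<in> S \<Longrightarrow> a i \<in> carrier_vec d"
  shows "finsum (module_mat TYPE(real) d d) (\<lambda>i. outer_square d (a i)) S
    = mat d d (\<lambda>(k, l). \<Sum>i\<in>S. a i $ k * a i $ l)"
  using assms
proof (induction S)
  case empty
  interpret abelian_group "module_mat TYPE(real) d d" by (rule abelian_group_mat)
  show ?case
    by (auto simp: module_mat_simps)
next
  case (insert i S)
  interpret abelian_group "module_mat TYPE(real) d d" by (rule abelian_group_mat)
  show ?case
    using insert
    by (subst finsum_insert) (auto simp: module_mat_simps index_outer_square intro!: eq_matI)
qed

lemma ddf_matrix_scaled_unit_vecs:
  assumes "D \<in> carrier_mat n n" "S \<subseteq> {..<n}"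
  shows "ddf_matrix n D (\<lambda>i. c \<cdot>\<^sub>v unit_vec n i) S
    = D + mat n n (\<lambda>(k, l). if k = l \<and> k \<in> S then c\<^sup>2 else 0)"
proof -
  have fin: "finite S"
    using assms(2) finite_subset by blast
  have "(\<Sum>i\<in>S. (c \<cdot>\<^sub>v unit_vec n i) $ k * (c \<cdot>\<^sub>v unit_vec n i) $ l)
      = (if k = l \<and> k \<in> S then c\<^sup>2 else 0)" if "k < n" "l < n" for k l
  proof -
    have "(\<Sum>i\<in>S. (c \<cdot>\<^sub>v unit_vec n i) $ k * (c \<cdot>\<^sub>v unit_vec n i) $ l)
        = (\<Sum>i\<in>S. if i = k then (if k = l then c\<^sup>2 else 0) else 0)"
      using that assms(2) by (intro sum.cong) (auto simp: unit_vec_def power2_eq_square)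
    then show ?thesis
      using fin by simp
  qed
  then show ?thesis
    unfolding ddf_matrix_def using fin
    by (subst finsum_outer_square) (auto intro!: arg_cong2[of _ _ _ _ "(+)"] eq_matI)
qed

text \<open>The diagonal part contributes a nonnegatively weighted sum of squares to the form. This
  serves to show that the data fusion matrix has nonzero determinant, so that its logarithm can be
  split off.\<close>

lemma sym_pos_def_add_nonneg_diagonal:
  assumes D: "D \<in> sym_pos_def n" and g: "\<And>i. i < n \<Longrightarrow> g i \<ge> 0"
  shows "D + mat n n (\<lambda>(k, l). if k = l then g k else 0) \<in> sym_pos_def n" (is "D + ?P \<in> _")
proof -
  note c = sym_pos_defD(1)[OF D]
  have "x \<bullet> ((D + ?P) *\<^sub>v x) > 0" if x: "x \<in> carrier_vec n" "x \<noteq> 0\<^sub>v n" for x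
  proof -
    have "(\<Sum>l = 0..<n. (if k = l then g k else 0) * x $ l) = g k * x $ k" if "k < n" for k
    proof -
      have "(\<Sum>l = 0..<n. (if k = l then g k else 0) * x $ l)
          = (\<Sum>l = 0..<n. if k = l then g k * x $ k else 0)"
        by (intro sum.cong) auto
      then show ?thesis
        using that by simp
    qed
    then have "?P *\<^sub>v x = vec n (\<lambda>k. g k * x $ k)"
      using x by (intro eq_vecI) (auto simp: scalar_prod_def row_def)
    then have "x \<bullet> (?P *\<^sub>v x) = (\<Sum>k<n. g k * (x $ k)\<^sup>2)"
      using x by (simp add: scalar_prod_def power2_eq_square lessThan_atLeast0 mult_ac)
    also have "\<dots> \<ge> 0"
      using g by (intro sum_nonneg) auto
    finally have "x \<bullet> (?P *\<^sub>v x) \<ge> 0" .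
    moreover have "x \<bullet> ((D + ?P) *\<^sub>v x) = x \<bullet> (D *\<^sub>v x) + x \<bullet> (?P *\<^sub>v x)"
      using x c mult_mat_vec_carrier[of D n n x] mult_mat_vec_carrier[of ?P n n x]
      by (simp add: add_mult_distrib_mat_vec[of _ n n] scalar_prod_add_distrib[of _ n])
    ultimately show ?thesis
      using sym_pos_defD(3)[OF D x] by simp
  qed
  moreover have "transpose_mat (D + ?P) = D + ?P"
  proof -
    have "D $$ (j, i) = D $$ (i, j)" if "i < n" "j < n" for i j
      using that c sym_pos_defD(2)[OF D] by (metis carrier_matD index_transpose_mat(1))
    then show ?thesis
      using c by (intro eq_matI) auto
  qed
  ultimately show ?thesis
    using c by (auto simp: sym_pos_def_def)
qed

section \<open>Determinants and principal submatrices\<close>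

text \<open>The sign of \<open>p\<close> enters once for the rows and once for the columns, and its
  square is 1. Columns are permuted as rows of the transpose.\<close>

lemma det_permute_rows_cols:
  fixes A :: "'a :: idom mat"
  assumes A: "A \<in> carrier_mat n n" and p: "p permutes {0..<n}"
  shows "det (mat n n (\<lambda>(i, j). A $$ (p i, p j))) = det A"
proof -
  have lt: "p i < n" if "i < n" for i
    using permutes_in_image[OF p, of i] that by simp
  define B where "B = mat n n (\<lambda>(i, j). A $$ (p i, j))"
  have B: "B \<in> carrier_mat n n"
    by (simp add: B_def)
  have "mat n n (\<lambda>(i, j). A $$ (p i, p j))
      = transpose_mat (mat n n (\<lambda>(i, j). transpose_mat B $$ (p i, j)))"
    using lt by (intro eq_matI) (auto simp: B_def)
  then have "det (mat n n (\<lambda>(i, j). A $$ (p i, p j)))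
      = det (mat n n (\<lambda>(i, j). transpose_mat B $$ (p i, j)))"
    by (simp add: det_transpose[of _ n])
  also have "\<dots> = signof p * det B"
    using B p by (subst det_permute_rows) (auto simp: det_transpose)
  also have "det B = signof p * det A"
    unfolding B_def by (rule det_permute_rows[OF A p])
  finally show ?thesis
    by (simp add: sign_def)
qed

lemma pick_bij_betw:
  assumes "finite S"
  shows "bij_betw (pick S) {..<card S} S"
proof -
  have inj: "inj_on (pick S) {..<card S}"
    by (intro linorder_inj_onI) (auto dest: pick_mono_le)
  have "pick S ` {..<card S} \<subseteq> S"
    by (auto intro: pick_in_set_le)
  then have "pick S ` {..<card S} = S"
    using assms inj by (intro card_subset_eq) (auto simp: card_image)
  with inj show ?thesis
    by (simp add: bij_betw_def)
qed

text \<open>Moving the indices in \<open>S\<close> to the front turns the unit columns into a zero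
  block above an identity block, so the matrix becomes block lower triangular.\<close>

lemma det_eq_det_submatrix_if_unit_cols:
  fixes A :: "'a :: idom mat"
  assumes A: "A \<in> carrier_mat n n" and S: "S \<subseteq> {..<n}"
    and unit: "\<And>i j. i < n \<Longrightarrow> j < n \<Longrightarrow> j \<notin> S \<Longrightarrow> A $$ (i, j) = (if i = j then 1 else 0)"
  shows "det A = det (submatrix A S S)"
proof -
  define s where "s = card S"
  have fin: "finite S"
    using S finite_subset by blast
  have s: "s \<le> n"
    using card_mono[OF _ S] by (simp add: s_def)
  have bp: "bij_betw (pick S) {..<s} S"
    unfolding s_def by (rule pick_bij_betw[OF fin])
  have "card {s..<n} = card ({..<n} - S)"
    using S fin by (simp add: card_Diff_subset s_def)
  then obtain h where h: "bij_betw h {s..<n} ({..<n} - S)"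
    using finite_same_card_bij[of "{s..<n}" "{..<n} - S"] by auto
  \<comment> \<open>Using \<open>pick S\<close> on the first \<open>s\<close> indices makes the
    upper left block literally \<open>submatrix A S S\<close>, with the same order of indices. The
    value \<open>i\<close> beyond \<open>n\<close> is what \<open>permutes\<close> demands.\<close>
  define p where "p i = (if i < s then pick S i else if i < n then h i else i)" for i
  have "bij_betw p {..<s} S"
    using bp by (rule bij_betw_cong[THEN iffD1, rotated]) (simp add: p_def)
  moreover have "bij_betw p {s..<n} ({..<n} - S)"
    using h by (rule bij_betw_cong[THEN iffD1, rotated]) (simp add: p_def)
  ultimately have "bij_betw p ({..<s} \<union> {s..<n}) (S \<union> ({..<n} - S))"
    by (rule bij_betw_combine) auto
  moreover have "{..<s} \<union> {s..<n} = {0..<n}" "S \<union> ({..<n} - S) = {0..<n}"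
    using s S by auto
  ultimately have p: "p permutes {0..<n}"
    using s by (intro bij_imp_permutes) (auto simp: p_def)
  have lt: "p i < n" if "i < n" for i
    using permutes_in_image[OF p, of i] that by simp
  have inj: "p i = p j \<longleftrightarrow> i = j" for i j
    using permutes_inj[OF p] by (auto dest: injD)
  have outside: "p j \<notin> S" if "s \<le> j" "j < n" for j
    using h that by (auto simp: p_def bij_betw_def)
  \<comment> \<open>\<open>submatrix\<close> takes its dimensions from the cardinality of this
    set.\<close>
  have card_S: "card {i. i < n \<and> i \<in> S} = s"
    using S by (auto simp: s_def intro!: arg_cong[of _ _ card])
  define L where "L = mat (n - s) s (\<lambda>(i, j). A $$ (p (i + s), p j))"
  have sub: "submatrix A S S \<in> carrier_mat s s"
    using A card_S by (auto simp: submatrix_def)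
  have "mat n n (\<lambda>(i, j). A $$ (p i, p j))
      = four_block_mat (submatrix A S S) (0\<^sub>m s (n - s)) L (1\<^sub>m (n - s))" (is "?l = ?r")
  proof (rule eq_matI)
    fix i j
    assume "i < dim_row ?r" "j < dim_col ?r"
    then have ij: "i < n" "j < n"
      using sub s by auto
    show "?l $$ (i, j) = ?r $$ (i, j)"
    proof (cases "j < s")
      case True
      then show ?thesis
        using ij s A sub card_S by (auto simp: L_def submatrix_def p_def)
    next
      case False
      then have "A $$ (p i, p j) = (if i = j then 1 else 0)"
        using unit[OF lt lt outside] ij inj by auto
      then show ?thesis
        using False ij s sub by auto
    qed
  qed (use sub s in auto)
  then have "det A = det (four_block_mat (submatrix A S S) (0\<^sub>m s (n - s)) L (1\<^sub>m (n - s)))"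
    using det_permute_rows_cols[OF A p] by simp
  also have "\<dots> = det (submatrix A S S)"
    using det_four_block_mat_upper_right_zero[OF sub refl, of L "n - s" "1\<^sub>m (n - s)"]
    by (simp add: L_def)
  finally show ?thesis .
qed

lemma det_mult_inverse_plus_diagonal:
  fixes C D :: "real mat"
  assumes C: "C \<in> carrier_mat n n" and D: "D \<in> carrier_mat n n" and t: "t \<noteq> 0"
    and inv: "(C - t \<cdot>\<^sub>m 1\<^sub>m n) * D = 1\<^sub>m n" and S: "S \<subseteq> {..<n}"
  shows "det (C - t \<cdot>\<^sub>m 1\<^sub>m n) * det (D + mat n n (\<lambda>(k, l). if k = l \<and> k \<in> S then 1 / t else 0))
    = (1 / t) ^ card S * det (submatrix C S S)"
    (is "det ?M * det (D + ?P) = _")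
proof -
  define N where "N = 1\<^sub>m n + ?M * ?P"
  have M: "?M \<in> carrier_mat n n"
    using C by (auto simp: minus_carrier_mat)
  have N: "N \<in> carrier_mat n n"
    using M by (auto simp: N_def)
  have "?M * (D + ?P) = N"
    using mult_add_distrib_mat[OF M D, of ?P] inv by (simp add: N_def)
  then have "det ?M * det (D + ?P) = det N"
    using det_mult[OF M, of "D + ?P"] D by simp
  have N_index: "N $$ (i, j) = (if i = j then 1 else 0) + (if j \<in> S then ?M $$ (i, j) / t else 0)"
    if "i < n" "j < n" for i j
  proof -
    have "(?M * ?P) $$ (i, j) = (\<Sum>k = 0..<n. ?M $$ (i, k) * ?P $$ (k, j))"
      using that M by (simp add: scalar_prod_def)
    also have "\<dots> = (\<Sum>k = 0..<n. if k = j then (if j \<in> S then ?M $$ (i, j) / t else 0) else 0)"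
      using that by (intro sum.cong) auto
    finally show ?thesis
      using that M by (simp add: N_def)
  qed
  have card_S: "card {i. i < n \<and> i \<in> S} = card S"
    using S by (auto intro!: arg_cong[of _ _ card])
  have "det N = det (submatrix N S S)"
    using N S by (rule det_eq_det_submatrix_if_unit_cols) (simp add: N_index)
  \<comment> \<open>On the diagonal, the shift by \<open>t\<close> contributes -1 after division by
    \<open>t\<close>, which cancels the 1 coming from the identity matrix.\<close>
  also have "submatrix N S S = (1 / t) \<cdot>\<^sub>m submatrix C S S"
  proof (rule eq_matI)
    fix i j
    assume "i < dim_row ((1 / t) \<cdot>\<^sub>m submatrix C S S)" "j < dim_col ((1 / t) \<cdot>\<^sub>m submatrix C S S)"
    then have ij: "i < card S" "j < card S"
      using C card_S by (auto simp: submatrix_def)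
    then have pick: "pick S i \<in> S" "pick S j \<in> S"
      by (auto intro: pick_in_set_le)
    then have "pick S i < n" "pick S j < n"
      using S by auto
    then show "submatrix N S S $$ (i, j) = ((1 / t) \<cdot>\<^sub>m submatrix C S S) $$ (i, j)"
      using ij C N card_S pick t by (auto simp: submatrix_def N_index field_simps)
  qed (use C N in \<open>auto simp: submatrix_def\<close>)
  also have "det \<dots> = (1 / t) ^ card S * det (submatrix C S S)"
    using C card_S by (simp add: submatrix_def)
  finally show ?thesis
    using \<open>det ?M * det (D + ?P) = det N\<close> by simp
qed

theorem theorem1:
  fixes n s :: nat and C :: "real mat"
  assumes "C \<in> sym_pos_def n" and "s \<in> {1..n}"
  shows "\<exists>D \<in> sym_pos_def n. \<exists>f :: nat \<Rightarrow> real vec. \<exists>\<gamma> :: real.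
           (\<forall>i<n. f i \<in> carrier_vec n) \<and>
           (\<forall>S. S \<subseteq> {..<n} \<and> card S = s \<longrightarrow>
              mesp_objective C S = ddf_objective n D f S + \<gamma>)"
proof -
  note C = sym_pos_defD(1)[OF assms(1)]
  obtain t where t: "t > 0" and M: "C - t \<cdot>\<^sub>m 1\<^sub>m n \<in> sym_pos_def n" (is "?M \<in> _")
    using sym_pos_def_shift[OF assms(1)] by blast
  obtain D where D: "D \<in> sym_pos_def n" and inv: "?M * D = 1\<^sub>m n"
    using sym_pos_def_inverse[OF M] by blast
  \<comment> \<open>The square root makes each outer square contribute exactly \<open>1 / t\<close>
    at its diagonal position.\<close>
  define f where "f i = (1 / sqrt t) \<cdot>\<^sub>v unit_vec n i" for i
  \<comment> \<open>The constant is the logarithm of the factor \<open>t ^ s * det ?M\<close>; it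
    depends on \<open>S\<close> only through the fixed cardinality \<open>s\<close>.\<close>
  have "mesp_objective C S = ddf_objective n D f S + (ln (det ?M) + real s * ln t)"
    if S: "S \<subseteq> {..<n}" and card_S: "card S = s" for S
  proof -
    define K where "K = D + mat n n (\<lambda>(k, l). if k = l \<and> k \<in> S then 1 / t else 0)"
    have K_eq: "ddf_matrix n D f S = K"
      using ddf_matrix_scaled_unit_vecs[OF sym_pos_defD(1)[OF D] S, of "1 / sqrt t"] t
      by (simp add: f_def[abs_def] K_def power_divide cong: if_cong)
    \<comment> \<open>The nested conditional exhibits the added matrix as a diagonal with
      nonnegative weights \<open>g\<close>.\<close>
    have "K = D + mat n n (\<lambda>(k, l). if k = l then (if k \<in> S then 1 / t else 0) else 0)"
      unfolding K_def by (intro arg_cong2[of _ _ _ _ "(+)"] eq_matI) auto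
    then have "K \<in> sym_pos_def n"
      using sym_pos_def_add_nonneg_diagonal[OF D, of "\<lambda>k. if k \<in> S then 1 / t else 0"] t by simp
    then have K: "det K \<noteq> 0"
      by (rule sym_pos_def_det_nonzero)
    have eq: "det (submatrix C S S) = t ^ s * (det ?M * det K)"
      using det_mult_inverse_plus_diagonal[OF C sym_pos_defD(1)[OF D] _ inv S] t card_S
      by (simp add: K_def power_divide)
    \<comment> \<open>In Isabelle \<open>ln x = ln \<bar>x\<bar>\<close>, so nonzero determinants suffice for \<open>ln_mult\<close>.\<close>
    show ?thesis
      unfolding mesp_objective_def ddf_objective_def K_eq eq
      using t K sym_pos_def_det_nonzero[OF M] by (simp add: ln_mult ln_realpow)
  qed
  then show ?thesis
    using D by (intro bexI[of _ D] exI[of _ f] exI[of _ "ln (det ?M) + real s * ln t"])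
      (auto simp: f_def)
qed

end
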